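(* Let $G$ be a connected graph. The following two statements are equivalent. (1) $\overline{\Theta}_G^*$ is $1$-trivial. (2) One of the following holds: (I) $|V(G)|\leq 4$ and $G$ is not a $K_3$, not a diamond and not a $K_4$; (II) $|V(G)|\geq 5$ and $G$ is $K_3$-free or contains at least one of the following as an induced subgraph: a $K_5$, a paw, a $P_4$.
   Context: Graphs are simple and undirected, with non-empty vertex set; $d$ is the shortest-path distance in $G$. For edges $e=\{a,b\}$ and $f=\{x,y\}$ the relation $\Theta_G$ on $E(G)$ is defined by $(e,f)\in\Theta_G$ iff $d(a,x)+d(b,y)\neq d(a,y)+d(b,x)$. The relation $\overline{\Theta}_G$ on $E(G)$ is defined by $(e,f)\in\overline{\Theta}_G$ iff $e=f$, or $e\neq f$ and $(e,f)\notin\Theta_G$. $R^*$ denotes the transitive closure of a reflexive symmetric relation $R$; $R^*$ is $1$-trivial if it has only one equivalence class (if $G$ has no edges, $R^*$ counts as $1$-trivial). $K_n$ is the complete graph on $n$ vertices, $P_4$ the path on $4$ vertices, the diamond is $K_{1,1,2}$ ($K_4$ minus one edge), and the paw is a triangle with one additional vertex adjacent to exactly one vertex of the triangle. $G$ is $H$-free if it has no induced subgraph isomorphic to $H$. *)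

theory Defs
  imports Main
begin

type_synonym 'a ugraph = "'a set \<times> 'a set set"

abbreviation verts :: "'a ugraph \<Rightarrow> 'a set" where
  "verts G \<equiv> fst G"

abbreviation edges :: "'a ugraph \<Rightarrow> 'a set set" where
  "edges G \<equiv> snd G"

text \<open>The vertex set may be infinite.\<close>

definition simple_graph :: "'a ugraph \<Rightarrow> bool" where
  "simple_graph G \<longleftrightarrow>
     verts G \<noteq> {} \<and>
     edges G \<subseteq> {{u, v} | u v. u \<in> verts G \<and> v \<in> verts G \<and> u \<noteq> v}"

text \<open>A path is given by its list of vertices, so its length is one less than that of the list.\<close>

definition is_path :: "'a ugraph \<Rightarrow> 'a \<Rightarrow> 'a list \<Rightarrow> 'a \<Rightarrow> bool" where
  "is_path G u p v \<longleftrightarrow>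
     p \<noteq> [] \<and> hd p = u \<and> last p = v \<and> distinct p \<and> set p \<subseteq> verts G \<and>
     (\<forall>i. Suc i < length p \<longrightarrow> {p ! i, p ! Suc i} \<in> edges G)"

definition connected_graph :: "'a ugraph \<Rightarrow> bool" where
  "connected_graph G \<longleftrightarrow> (\<forall>u\<in>verts G. \<forall>v\<in>verts G. \<exists>p. is_path G u p v)"

text \<open>Only meaningful for vertices joined by a path; it is used for connected graphs only.\<close>

definition gdist :: "'a ugraph \<Rightarrow> 'a \<Rightarrow> 'a \<Rightarrow> nat" where
  "gdist G u v = (LEAST n. \<exists>p. is_path G u p v \<and> length p = Suc n)"

text \<open>Exchanging the names of the two ends of an edge swaps the two sides of the disequation, so
  the choice of names does not matter.\<close>

definition Theta :: "'a ugraph \<Rightarrow> 'a set rel" where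
  "Theta G = {(e, f). e \<in> edges G \<and> f \<in> edges G \<and>
     (\<exists>a b x y. e = {a, b} \<and> f = {x, y} \<and>
        gdist G a x + gdist G b y \<noteq> gdist G a y + gdist G b x)}"

definition Theta_bar :: "'a ugraph \<Rightarrow> 'a set rel" where
  "Theta_bar G = {(e, f). e \<in> edges G \<and> f \<in> edges G \<and>
     (e = f \<or> (e \<noteq> f \<and> (e, f) \<notin> Theta G))}"

text \<open>An equivalence relation \<open>R\<close> on \<open>A\<close> with a single class; by convention the relation on the
  empty set (which has no class) is included. A quotient of cardinality 1 is finite.\<close>

definition one_trivial :: "'b set \<Rightarrow> 'b rel \<Rightarrow> bool" where
  "one_trivial A R \<longleftrightarrow> A = {} \<or> card (A // R) = 1"

definition graph_iso :: "'a ugraph \<Rightarrow> 'b ugraph \<Rightarrow> bool" where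
  "graph_iso G H \<longleftrightarrow>
     (\<exists>f. bij_betw f (verts G) (verts H) \<and>
        (\<forall>u\<in>verts G. \<forall>v\<in>verts G. {u, v} \<in> edges G \<longleftrightarrow> {f u, f v} \<in> edges H))"

definition induced_subgraph :: "'a ugraph \<Rightarrow> 'a set \<Rightarrow> 'a ugraph" where
  "induced_subgraph G S = (S, {e \<in> edges G. e \<subseteq> S})"

definition contains_induced :: "'a ugraph \<Rightarrow> 'b ugraph \<Rightarrow> bool" where
  "contains_induced G H \<longleftrightarrow> (\<exists>S \<subseteq> verts G. graph_iso (induced_subgraph G S) H)"

abbreviation graph_free :: "'a ugraph \<Rightarrow> 'b ugraph \<Rightarrow> bool" where
  "graph_free G H \<equiv> \<not> contains_induced G H"

definition complete_graph :: "nat \<Rightarrow> nat ugraph" where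
  "complete_graph n = ({..<n}, {{i, j} | i j. i < n \<and> j < n \<and> i \<noteq> j})"

definition path_graph :: "nat \<Rightarrow> nat ugraph" where
  "path_graph n = ({..<n}, {{i, Suc i} | i. Suc i < n})"

definition diamond_graph :: "nat ugraph" where
  "diamond_graph = ({..<4}, edges (complete_graph 4) - {{0, 1}})"

definition paw_graph :: "nat ugraph" where
  "paw_graph = ({..<4}, edges (complete_graph 3) \<union> {{2, 3}})"

end

theory Submission imports Defs begin

text \<open>Incident edges \<open>xy\<close>, \<open>yz\<close> without \<open>xz\<close> are related, so in a connected graph only the
  triangles matter: the relation has one class as soon as the edges of each triangle share a class.
  If non-adjacency is not transitive, any triangle is pulled into one class by the paws close to it.
  Otherwise the graph is complete multipartite, and two edges meeting four distinct parts are
  related, while two edges meeting three parts are not. With at least five parts this connects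
  everything; with three or four parts the classes correspond to the ways of pairing the parts.\<close>

section \<open>Relations with a single class, and copies of the pattern graphs\<close>

lemma one_trivial_iff:
  "one_trivial A R \<longleftrightarrow> (\<forall>e\<in>A. \<forall>f\<in>A. R `` {e} = R `` {f})"
proof -
  have q: "A // R = (\<lambda>e. R `` {e}) ` A"
    by (auto simp: quotient_def)
  show ?thesis
  proof
    assume "one_trivial A R"
    then have "\<forall>x\<in>A // R. \<forall>y\<in>A // R. x = y"
      unfolding one_trivial_def by (metis card_1_singletonE equals0D quotient_empty singletonD)
    then show "\<forall>e\<in>A. \<forall>f\<in>A. R `` {e} = R `` {f}"
      by (simp only: q ball_simps)
  next
    assume *: "\<forall>e\<in>A. \<forall>f\<in>A. R `` {e} = R `` {f}"
    show "one_trivial A R"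
    proof (cases "A = {}")
      case False
      then obtain e where "e \<in> A" by blast
      have "A // R = (\<lambda>_. R `` {e}) ` A"
        unfolding q by (rule image_cong[OF refl]) (rule *[rule_format, OF _ \<open>e \<in> A\<close>])
      then have "A // R = {R `` {e}}"
        using False by (simp only: image_constant_conv if_False)
      then show ?thesis
        by (simp add: one_trivial_def)
    qed (simp add: one_trivial_def)
  qed
qed

lemma complete_graph_edge_iff [simp]:
  "{i, j} \<in> edges (complete_graph n) \<longleftrightarrow> i < n \<and> j < n \<and> i \<noteq> j"
  by (auto simp: complete_graph_def doubleton_eq_iff)

lemma complete_graph_no_loop [simp]: "{i} \<notin> edges (complete_graph n)"
  using complete_graph_edge_iff[of i i n] by simp

lemma diamond_graph_edge_iff [simp]:
  "{i, j} \<in> edges diamond_graph \<longleftrightarrow> i < 4 \<and> j < 4 \<and> i \<noteq> j \<and> {i, j} \<noteq> {0, 1}"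
  by (auto simp: diamond_graph_def)

lemma paw_graph_edge_iff [simp]:
  "{i, j} \<in> edges paw_graph \<longleftrightarrow> i < 3 \<and> j < 3 \<and> i \<noteq> j \<or> {i, j} = {2, 3}"
  by (auto simp: paw_graph_def)

lemma path_graph_edge_iff [simp]:
  "{i, j} \<in> edges (path_graph n) \<longleftrightarrow> i < n \<and> j < n \<and> (j = Suc i \<or> i = Suc j)"
  by (auto simp: path_graph_def doubleton_eq_iff)

lemma verts_pattern_graphs [simp]:
  "verts (complete_graph n) = {..<n}" "verts diamond_graph = {..<4}"
  "verts paw_graph = {..<4}" "verts (path_graph n) = {..<n}"
  by (simp_all add: complete_graph_def diamond_graph_def paw_graph_def path_graph_def)

text \<open>The list names the vertices of \<open>G\<close> in the order of their numbers in
  \<open>H\<close>, and the isomorphism is the inverse of indexing. A concrete pattern is thus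
  checked by a finite case distinction on indices.\<close>

lemma graph_iso_listI:
  fixes H :: "nat ugraph"
  assumes "verts H = {..<length xs}" "distinct xs" "set xs = verts G"
    and "\<And>i j. i < length xs \<Longrightarrow> j < length xs \<Longrightarrow>
      {xs ! i, xs ! j} \<in> edges G \<longleftrightarrow> {i, j} \<in> edges H"
  shows "graph_iso G H"
proof -
  let ?g = "(!) xs" and ?n = "length xs"
  have b: "bij_betw ?g {..<?n} (verts G)"
    using assms by (simp add: bij_betw_nth)
  let ?f = "the_inv_into {..<?n} ?g"
  have fb: "bij_betw ?f (verts G) {..<?n}"
    using b by (rule bij_betw_the_inv_into)
  have gf: "?f u < ?n" "xs ! ?f u = u" if "u \<in> verts G" for u
    using that fb b by (auto simp: bij_betw_def f_the_inv_into_f)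
  have "{u, v} \<in> edges G \<longleftrightarrow> {?f u, ?f v} \<in> edges H"
    if "u \<in> verts G" "v \<in> verts G" for u v
    using assms(4)[of "?f u" "?f v"] gf[OF that(1)] gf[OF that(2)] by simp
  with fb show ?thesis
    unfolding graph_iso_def assms(1) by blast
qed

lemma graph_iso_natE:
  fixes H :: "nat ugraph"
  assumes "graph_iso G H" "verts H = {..<n}"
  obtains g where "bij_betw g {..<n} (verts G)"
    "\<And>i j. i < n \<Longrightarrow> j < n \<Longrightarrow> {g i, g j} \<in> edges G \<longleftrightarrow> {i, j} \<in> edges H"
proof -
  from assms obtain f where f: "bij_betw f (verts G) {..<n}"
    "\<And>u v. u \<in> verts G \<Longrightarrow> v \<in> verts G \<Longrightarrow> {u, v} \<in> edges G \<longleftrightarrow> {f u, f v} \<in> edges H"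
    unfolding graph_iso_def by auto
  let ?g = "the_inv_into (verts G) f"
  have b: "bij_betw ?g {..<n} (verts G)"
    using f(1) by (rule bij_betw_the_inv_into)
  have "?g i \<in> verts G" "f (?g i) = i" if "i < n" for i
    using that b f(1) by (auto simp: bij_betw_def f_the_inv_into_f)
  with f(2) b that show ?thesis
    by metis
qed

lemma contains_induced_listI:
  fixes H :: "nat ugraph"
  assumes "verts H = {..<length xs}" "distinct xs" "set xs \<subseteq> verts G"
    and "\<And>i j. i < length xs \<Longrightarrow> j < length xs \<Longrightarrow>
      {xs ! i, xs ! j} \<in> edges G \<longleftrightarrow> {i, j} \<in> edges H"
  shows "contains_induced G H"
proof -
  have "graph_iso (induced_subgraph G (set xs)) H"
    by (rule graph_iso_listI[where xs = xs]) (use assms in \<open>auto simp: induced_subgraph_def\<close>)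
  with assms(3) show ?thesis
    unfolding contains_induced_def by blast
qed

lemma contains_induced_natE:
  fixes H :: "nat ugraph"
  assumes "contains_induced G H" "verts H = {..<n}"
  obtains g where "\<And>i. i < n \<Longrightarrow> g i \<in> verts G"
    "\<And>i j. i < n \<Longrightarrow> j < n \<Longrightarrow> {g i, g j} \<in> edges G \<longleftrightarrow> {i, j} \<in> edges H"
proof -
  from assms(1) obtain S where S: "S \<subseteq> verts G" "graph_iso (induced_subgraph G S) H"
    unfolding contains_induced_def by blast
  from graph_iso_natE[OF S(2) assms(2)] obtain g where
    g: "bij_betw g {..<n} S"
    "\<And>i j. i < n \<Longrightarrow> j < n \<Longrightarrow> {g i, g j} \<in> edges (induced_subgraph G S) \<longleftrightarrow> {i, j} \<in> edges H"
    by (auto simp: induced_subgraph_def)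
  have gS: "g i \<in> S" if "i < n" for i
    using g(1) that by (auto simp: bij_betw_def)
  show ?thesis
    using that[of g] gS g(2) S(1) by (auto simp: induced_subgraph_def)
qed

section \<open>Paths and distances\<close>

lemma is_path_rev:
  assumes "is_path G u p v"
  shows "is_path G v (rev p) u"
proof -
  have "{rev p ! i, rev p ! Suc i} \<in> edges G" if "Suc i < length p" for i
  proof -
    \<comment> \<open>Positions \<open>i\<close> and \<open>Suc i\<close> of the reversed list are
      positions \<open>Suc k\<close> and \<open>k\<close> of \<open>p\<close>.\<close>
    define k where "k = length p - Suc (Suc i)"
    have "rev p ! i = p ! Suc k" "rev p ! Suc i = p ! k" "Suc k < length p"
      using that by (auto simp: rev_nth k_def Suc_diff_Suc)
    then show ?thesis
      using assms by (simp add: is_path_def insert_commute)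
  qed
  with assms show ?thesis
    by (auto simp: is_path_def hd_rev last_rev)
qed

lemma gdist_commute: "gdist G u v = gdist G v u"
proof -
  have "(\<exists>p. is_path G u p v \<and> length p = Suc n) \<longleftrightarrow> (\<exists>p. is_path G v p u \<and> length p = Suc n)" for n
    by (metis is_path_rev length_rev)
  then show ?thesis
    by (simp add: gdist_def)
qed

locale connected_simple_graph =
  fixes G :: "'a ugraph"
  assumes simple: "simple_graph G" and connected: "connected_graph G"
begin

abbreviation adj :: "'a \<Rightarrow> 'a \<Rightarrow> bool" where
  "adj u v \<equiv> {u, v} \<in> edges G"

lemma adj_commute: "adj u v \<longleftrightarrow> adj v u"
  by (simp add: insert_commute)

lemma adjD: "adj u v \<Longrightarrow> u \<in> verts G \<and> v \<in> verts G \<and> u \<noteq> v"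
  using simple unfolding simple_graph_def by (auto simp: doubleton_eq_iff)

lemma adj_irrefl [simp]: "{u} \<notin> edges G"
  using adjD[of u u] by auto

lemma edgeE:
  assumes "e \<in> edges G"
  obtains u v where "e = {u, v}" "adj u v"
proof -
  from assms simple have "e \<in> {{u, v} |u v. u \<in> verts G \<and> v \<in> verts G \<and> u \<noteq> v}"
    unfolding simple_graph_def by (rule_tac subsetD) simp_all
  with assms that show ?thesis by blast
qed

text \<open>Induction on the position along a path; this is the form in which connectedness is used
  below.\<close>

lemma reachable_induct:
  assumes "u \<in> verts G" "v \<in> verts G" "P u"
    and step: "\<And>a b. P a \<Longrightarrow> adj a b \<Longrightarrow> P b"
  shows "P v"
proof -
  from assms connected obtain p where p: "is_path G u p v"
    unfolding connected_graph_def by blast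
  have "P (p ! i)" if "i < length p" for i
    using that
  proof (induction i)
    case 0
    with p \<open>P u\<close> show ?case by (metis hd_conv_nth is_path_def)
  next
    case (Suc i)
    with p step show ?case unfolding is_path_def by (meson Suc_lessD)
  qed
  with p show ?thesis
    unfolding is_path_def by (metis diff_less last_conv_nth length_greater_0_conv zero_less_one)
qed

lemma gdist_self: "u \<in> verts G \<Longrightarrow> gdist G u u = 0"
  unfolding gdist_def by (rule Least_equality) (auto simp: is_path_def intro: exI[of _ "[u]"])

lemma gdist_adj:
  assumes "adj u v"
  shows "gdist G u v = 1"
  unfolding gdist_def
proof (rule Least_equality)
  show "\<exists>p. is_path G u p v \<and> length p = Suc 1"
    using adjD[OF assms] assms by (intro exI[of _ "[u, v]"]) (auto simp: is_path_def)
next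
  fix n assume "\<exists>p. is_path G u p v \<and> length p = Suc n"
  with adjD[OF assms] show "1 \<le> n"
    by (cases n) (auto simp: is_path_def length_Suc_conv)
qed

lemma gdist_two:
  assumes "adj u w" "adj w v" "\<not> adj u v" "u \<noteq> v"
  shows "gdist G u v = 2"
  unfolding gdist_def
proof (rule Least_equality)
  show "\<exists>p. is_path G u p v \<and> length p = Suc 2"
    using adjD[OF assms(1)] adjD[OF assms(2)] assms
    by (intro exI[of _ "[u, w, v]"]) (auto simp: is_path_def less_Suc_eq nth_Cons')
next
  fix n assume "\<exists>p. is_path G u p v \<and> length p = Suc n"
  then obtain p where p: "is_path G u p v" "length p = Suc n" by blast
  have "n \<noteq> 0"
    using p assms(4) by (auto simp: is_path_def length_Suc_conv)
  moreover have "n \<noteq> 1"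
    using p assms(3) by (auto simp: is_path_def length_Suc_conv)
  ultimately show "2 \<le> n" by simp
qed

section \<open>The edge relation and its classes\<close>

lemma Theta_iff:
  "adj a b \<Longrightarrow> adj x y \<Longrightarrow> ({a, b}, {x, y}) \<in> Theta G \<longleftrightarrow>
    gdist G a x + gdist G b y \<noteq> gdist G a y + gdist G b x"
  unfolding Theta_def by (fastforce simp: doubleton_eq_iff)

lemma Theta_commute: "(e, f) \<in> Theta G \<Longrightarrow> (f, e) \<in> Theta G"
  unfolding Theta_def by (simp, metis gdist_commute add.commute)

abbreviation R :: "'a set rel" where
  "R \<equiv> (Theta_bar G)\<^sup>+"

text \<open>Reflexivity on the edges comes from the diagonal clause of \<open>Theta_bar\<close>;
  symmetry passes from \<open>Theta\<close> to its complement and on to the closure.\<close>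

lemma equiv_R: "equiv (edges G) R"
proof -
  have "R \<subseteq> edges G \<times> edges G"
    by (rule trancl_subset_Sigma) (auto simp: Theta_bar_def)
  moreover have "sym R"
    by (intro sym_trancl symI) (auto simp: Theta_bar_def dest: Theta_commute)
  ultimately show ?thesis
    by (auto intro!: equivI refl_onI r_into_trancl simp: Theta_bar_def)
qed

text \<open>Naming a class by the two ends of an edge turns chains of related edges into chains of
  equations.\<close>

definition cls :: "'a \<Rightarrow> 'a \<Rightarrow> 'a set set" where
  "cls u v = R `` {{u, v}}"

lemma cls_commute: "cls u v = cls v u"
  by (simp add: cls_def insert_commute)

lemma cls_eqI:
  assumes "adj a b" "adj x y"
    and "gdist G a x + gdist G b y = gdist G a y + gdist G b x"
  shows "cls a b = cls x y"
proof -
  have "({a, b}, {x, y}) \<in> Theta_bar G"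
    using assms by (auto simp: Theta_bar_def Theta_iff)
  then show ?thesis
    unfolding cls_def using equiv_class_eq[OF equiv_R] by blast
qed

lemma one_trivial_cls_iff:
  "one_trivial (edges G) R \<longleftrightarrow> (\<forall>a b x y. adj a b \<longrightarrow> adj x y \<longrightarrow> cls a b = cls x y)"
  unfolding one_trivial_iff cls_def by (metis edgeE)

text \<open>Both sums of distances are 2: \<open>1 + 1\<close> along the two edges, and
  \<open>2 + 0\<close> from the pair \<open>x\<close>, \<open>z\<close> and the shared vertex
  \<open>y\<close>. If \<open>x = z\<close>, the two edges coincide.\<close>

lemma cls_induced_P3:
  assumes "adj x y" "adj y z" "\<not> adj x z"
  shows "cls x y = cls y z"
proof (cases "x = z")
  case False
  with assms show ?thesis
    using gdist_adj[of x y] gdist_adj[of y z] gdist_two[of x y z] gdist_self[of y] adjD[of x y]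
    by (intro cls_eqI) auto
qed (simp add: cls_commute)

text \<open>All four distances between disjoint edges of a \<open>K\<^sub>4\<close> are 1, so both
  sums are 2.\<close>

lemma cls_K4:
  assumes "adj a b" "adj a c" "adj a d" "adj b c" "adj b d" "adj c d"
  shows "cls a b = cls c d"
  using assms by (intro cls_eqI) (simp_all add: gdist_adj)

section \<open>Paws and monochromatic triangles\<close>

definition paw :: "'a \<Rightarrow> 'a \<Rightarrow> 'a \<Rightarrow> 'a \<Rightarrow> bool" where
  "paw a b c d \<longleftrightarrow> adj a b \<and> adj a c \<and> adj b c \<and> adj c d \<and> \<not> adj a d \<and> \<not> adj b d"

text \<open>For the pendant edge \<open>cd\<close> and the opposite side \<open>ab\<close> the sums
  are \<open>1 + 2\<close> and \<open>2 + 1\<close>. Each of the two sides at \<open>c\<close> forms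
  an induced path with \<open>cd\<close>.\<close>

lemma paw_cls:
  assumes "paw a b c d"
  shows "cls a b = cls c d" "cls a c = cls c d" "cls b c = cls c d"
proof -
  have *: "adj a b" "adj a c" "adj b c" "adj c d" "\<not> adj a d" "\<not> adj b d"
    using assms by (auto simp: paw_def)
  then have "a \<noteq> d" "b \<noteq> d"
    by (auto simp: adj_commute)
  then show "cls a b = cls c d"
    using * gdist_two[of a c d] gdist_two[of b c d] by (intro cls_eqI) (simp_all add: gdist_adj)
  show "cls a c = cls c d" "cls b c = cls c d"
    using * cls_induced_P3[of a c d] cls_induced_P3[of b c d] by simp_all
qed

definition triangle :: "'a \<Rightarrow> 'a \<Rightarrow> 'a \<Rightarrow> bool" where
  "triangle x y z \<longleftrightarrow> adj x y \<and> adj y z \<and> adj x z"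

text \<open>The paw is recorded as well because each configuration making a triangle monochromatic
  below produces one; it is the induced subgraph that the theorem asks for.\<close>

definition mono_triangle :: "'a \<Rightarrow> 'a \<Rightarrow> 'a \<Rightarrow> bool" where
  "mono_triangle x y z \<longleftrightarrow>
     (\<exists>a b c d. paw a b c d) \<and> cls x y = cls y z \<and> cls x y = cls x z"

lemma triangle_rotate: "triangle x y z \<longleftrightarrow> triangle y z x"
  by (auto simp: triangle_def adj_commute)

lemma mono_triangle_rotate: "mono_triangle x y z \<longleftrightarrow> mono_triangle y z x"
  by (auto simp: mono_triangle_def cls_commute)

lemma triangle_swap: "triangle x y z \<longleftrightarrow> triangle y x z"
  by (auto simp: triangle_def adj_commute)

lemma mono_triangle_swap: "mono_triangle x y z \<longleftrightarrow> mono_triangle y x z"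
  by (auto simp: mono_triangle_def cls_commute)

lemma mono_triangleI:
  assumes "paw a b c d" "cls x y = cls y z" "cls x y = cls x z"
  shows "mono_triangle x y z"
  using assms unfolding mono_triangle_def by blast

text \<open>The triangle and \<open>w\<close> form a paw, whose three sides all lie in the class of
  the pendant edge.\<close>

lemma mono_if_one_neighbour:
  assumes "triangle x y z" "adj z w" "\<not> adj x w" "\<not> adj y w"
  shows "mono_triangle x y z"
proof -
  have "paw x y z w"
    using assms by (auto simp: triangle_def paw_def)
  then show ?thesis
    using paw_cls[of x y z w] by (intro mono_triangleI) auto
qed

text \<open>The edge \<open>vw\<close> is pendant to the triangle \<open>x\<close>,
  \<open>y\<close>, \<open>v\<close>. If \<open>v\<close> sees \<open>z\<close>, two further paws
  with the same pendant edge cover the other sides; if not, the induced paths \<open>v\<close>,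
  \<open>x\<close>, \<open>z\<close> and \<open>v\<close>, \<open>y\<close>, \<open>z\<close> carry
  the class over to them.\<close>

lemma mono_if_distance_two:
  assumes "triangle x y z" "adj x v" "adj y v" "adj v w"
    and "\<not> adj x w" "\<not> adj y w" "\<not> adj z w"
  shows "mono_triangle x y z"
proof -
  have xy: "paw x y v w"
    using assms by (auto simp: triangle_def paw_def)
  show ?thesis
  proof (cases "adj z v")
    case True
    with assms have "paw x z v w" "paw y z v w"
      by (auto simp: triangle_def paw_def)
    with xy show ?thesis
      using paw_cls(1)[of x y v w] paw_cls(1)[of x z v w] paw_cls(1)[of y z v w]
      by (intro mono_triangleI[OF xy]) simp_all
  next
    case False
    with assms have "cls v x = cls x z" "cls v y = cls y z"
      using cls_induced_P3[of v x z] cls_induced_P3[of v y z]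
      by (simp_all add: triangle_def adj_commute)
    with xy show ?thesis
      using paw_cls[OF xy] by (intro mono_triangleI[OF xy]) (metis cls_commute)+
  qed
qed

text \<open>In the next four lemmas the vertices \<open>u\<close>, \<open>v\<close>, \<open>w\<close> obstruct a complete multipartite
  structure in which \<open>x\<close>, \<open>y\<close>, \<open>z\<close> represent three of the parts.\<close>

lemma mono_if_adjacent_in_part:
  assumes "triangle x y z" "adj u x" "adj u y" "\<not> adj u z" "adj v x" "adj v y" "\<not> adj v z"
    and "adj u v"
  shows "mono_triangle x y z"
proof -
  have p: "paw u v x z" "paw u v y z"
    using assms by (auto simp: triangle_def paw_def adj_commute)
  \<comment> \<open>The edges \<open>xy\<close> and \<open>uv\<close> are opposite in a
    \<open>K\<^sub>4\<close>; the paws tie \<open>uv\<close> to the other two sides.\<close>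
  have "cls x y = cls u v"
    using assms by (intro cls_K4) (auto simp: triangle_def adj_commute)
  then show ?thesis
    using paw_cls(1)[OF p(1)] paw_cls(1)[OF p(2)] by (intro mono_triangleI[OF p(1)]) auto
qed

lemma mono_if_nonadjacent_across_parts:
  assumes "triangle x y z" "adj v x" "adj v y" "\<not> adj v z" "adj u x" "adj u z" "\<not> adj u y"
    and "\<not> adj u v"
  shows "mono_triangle x y z"
proof -
  have p: "paw v y x u" "paw z u x v"
    using assms by (auto simp: triangle_def paw_def adj_commute)
  \<comment> \<open>The paws put \<open>xy\<close>, \<open>xz\<close> and \<open>vy\<close> into the
    class of \<open>xu\<close>; the induced path \<open>v\<close>, \<open>y\<close>,
    \<open>z\<close> adds \<open>yz\<close>.\<close>
  have "cls v y = cls y z"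
    using assms by (intro cls_induced_P3) (auto simp: triangle_def adj_commute)
  then show ?thesis
    using paw_cls[OF p(1)] paw_cls[OF p(2)]
    by (intro mono_triangleI[OF p(1)]) (metis cls_commute)+
qed

lemma mono_if_nonadjacent_to_universal:
  assumes "triangle x y z" "adj v x" "adj v y" "\<not> adj v z" "adj u x" "adj u y" "adj u z"
    and "\<not> adj u v"
  shows "mono_triangle x y z"
proof -
  have p: "paw u z x v" "paw u z y v"
    using assms by (auto simp: triangle_def paw_def adj_commute)
  \<comment> \<open>The paws put \<open>xz\<close> and \<open>yz\<close> into the class of
    \<open>uz\<close>, which is opposite to \<open>xy\<close> in a \<open>K\<^sub>4\<close>.\<close>
  have "cls x y = cls u z"
    using assms by (intro cls_K4) (auto simp: triangle_def adj_commute)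
  then show ?thesis
    using paw_cls[OF p(1)] paw_cls[OF p(2)]
    by (intro mono_triangleI[OF p(1)]) (metis cls_commute)+
qed

lemma mono_if_universal_intransitive:
  assumes "triangle x y z"
    and "adj u x" "adj u y" "adj u z" "adj v x" "adj v y" "adj v z" "adj w x"
    and "adj u v" "\<not> adj u w" "\<not> adj v w"
  shows "mono_triangle x y z"
proof -
  have p: "paw u v x w"
    using assms by (auto simp: triangle_def paw_def adj_commute)
  \<comment> \<open>Each side of the triangle spans a \<open>K\<^sub>4\<close> with the edge
    \<open>uv\<close>.\<close>
  have "cls x y = cls u v" "cls y z = cls u v" "cls x z = cls u v"
    using assms cls_K4[of x y u v] cls_K4[of y z u v] cls_K4[of x z u v]
    by (simp_all add: triangle_def adj_commute)
  then show ?thesis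
    by (intro mono_triangleI[OF p]) auto
qed

section \<open>Triangles that are not monochromatic force a complete multipartite graph\<close>

definition two_neighbours :: "'a \<Rightarrow> 'a \<Rightarrow> 'a \<Rightarrow> 'a \<Rightarrow> bool" where
  "two_neighbours x y z v \<longleftrightarrow>
     adj v x \<and> adj v y \<or> adj v y \<and> adj v z \<or> adj v x \<and> adj v z"

text \<open>The property spreads along edges: if \<open>a\<close> has it and its neighbour
  \<open>b\<close> does not, then \<open>b\<close> sees one triangle vertex and completes a paw, or
  sees none and is the far vertex of \<open>mono_if_distance_two\<close>.\<close>

lemma two_neighbours_if_not_mono:
  assumes t: "triangle x y z" and "\<not> mono_triangle x y z" "v \<in> verts G"
  shows "two_neighbours x y z v"
proof (rule reachable_induct[of x v])
  show "x \<in> verts G" "two_neighbours x y z x"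
    using t adjD by (auto simp: triangle_def two_neighbours_def)
next
  fix a b
  assume *: "two_neighbours x y z a" "adj a b"
  have r: "triangle y z x" "triangle z x y" "\<not> mono_triangle y z x" "\<not> mono_triangle z x y"
    using assms triangle_rotate mono_triangle_rotate by metis+
  show "two_neighbours x y z b"
  proof (rule ccontr)
    assume n: "\<not> two_neighbours x y z b"
    have "\<not> adj b x" "\<not> adj b y" "\<not> adj b z"
      using n mono_if_one_neighbour[OF t] mono_if_one_neighbour[OF r(1)]
        mono_if_one_neighbour[OF r(2)] assms(2) r(3,4)
      by (auto simp: two_neighbours_def adj_commute)
    with * show False
      using mono_if_distance_two[OF t] mono_if_distance_two[OF r(1)]
        mono_if_distance_two[OF r(2)] assms(2) r(3,4)
      by (auto simp: two_neighbours_def adj_commute)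
  qed
qed fact

text \<open>The vertex \<open>a\<close> misses at most one triangle vertex. Missing \<open>y\<close>
  or, after swapping, \<open>x\<close> is a non-adjacency across parts, and missing none makes
  \<open>a\<close> universal; both would make the triangle monochromatic.\<close>

lemma same_part_if_not_mono:
  assumes t: "triangle x y z" and m: "\<not> mono_triangle x y z"
    and b: "\<not> adj b z" "b \<in> verts G" and a: "a \<in> verts G" "\<not> adj a b"
  shows "adj a x \<and> adj a y \<and> \<not> adj a z"
proof -
  have t': "triangle y x z" and m': "\<not> mono_triangle y x z"
    using t m triangle_swap mono_triangle_swap by metis+
  have b': "adj b x" "adj b y"
    using two_neighbours_if_not_mono[OF t m b(2)] b(1) by (auto simp: two_neighbours_def)
  have n: "two_neighbours x y z a"
    using two_neighbours_if_not_mono[OF t m a(1)] .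
  show ?thesis
    using n b b' a mono_if_nonadjacent_across_parts[OF t, of b a]
      mono_if_nonadjacent_across_parts[OF t', of b a]
      mono_if_nonadjacent_to_universal[OF t, of b a] m m'
    by (auto simp: two_neighbours_def)
qed

text \<open>Non-adjacency is reflexive and symmetric, so transitivity makes it an equivalence, whose
  classes are the parts of a complete multipartite graph.\<close>

definition multipartite :: bool where
  "multipartite \<longleftrightarrow>
     (\<forall>a\<in>verts G. \<forall>b\<in>verts G. \<forall>c\<in>verts G. \<not> adj a b \<longrightarrow> \<not> adj b c \<longrightarrow> \<not> adj a c)"

text \<open>By \<open>same_part_if_not_mono\<close>, \<open>a\<close> and \<open>c\<close> would
  both miss exactly \<open>z\<close>, and an edge between them is the case of
  \<open>mono_if_adjacent_in_part\<close>.\<close>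

lemma part_independent_if_not_mono:
  assumes t: "triangle x y z" and m: "\<not> mono_triangle x y z"
    and "b \<in> verts G" "\<not> adj b z" "\<not> adj a b" "\<not> adj b c"
  shows "\<not> adj a c"
proof
  assume ac: "adj a c"
  have "\<not> adj c b" using assms(6) by (simp add: adj_commute)
  then have "adj a x \<and> adj a y \<and> \<not> adj a z" "adj c x \<and> adj c y \<and> \<not> adj c z"
    using same_part_if_not_mono[OF t m assms(4,3)] assms(5) adjD[OF ac] by blast+
  with ac m show False
    using mono_if_adjacent_in_part[OF t] by blast
qed

text \<open>Let \<open>b\<close> miss the adjacent vertices \<open>a\<close> and \<open>c\<close>.
  Then \<open>b\<close> sees the whole triangle by \<open>part_independent_if_not_mono\<close>. So
  do \<open>a\<close> and \<open>c\<close>, since a triangle vertex missed by one of them would be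
  missed by \<open>b\<close>. This is the last obstruction.\<close>

lemma mono_triangle_if_not_multipartite:
  assumes t: "triangle x y z" and "\<not> multipartite"
  shows "mono_triangle x y z"
proof (rule ccontr)
  assume m: "\<not> mono_triangle x y z"
  from assms(2) obtain a b c where
    abc: "a \<in> verts G" "b \<in> verts G" "c \<in> verts G" "\<not> adj a b" "\<not> adj b c" "adj a c"
    unfolding multipartite_def by blast
  have r: "triangle y z x" "triangle z x y" "\<not> mono_triangle y z x" "\<not> mono_triangle z x y"
    using t m triangle_rotate mono_triangle_rotate by metis+
  have b: "adj b x" "adj b y" "adj b z"
    using part_independent_if_not_mono[OF t m, of b a c]
      part_independent_if_not_mono[OF r(1,3), of b a c]
      part_independent_if_not_mono[OF r(2,4), of b a c] abc by blast+
  have *: "adj v x \<and> adj v y \<and> adj v z" if "v \<in> verts G" "\<not> adj v b" for v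
    using that b same_part_if_not_mono[OF t m, of v b] same_part_if_not_mono[OF r(1,3), of v b]
      same_part_if_not_mono[OF r(2,4), of v b] abc(2) by (auto simp: adj_commute)
  have "\<not> adj c b" using abc(5) by (simp add: adj_commute)
  with *[of a] *[of c] b abc m show False
    using mono_if_universal_intransitive[OF t, of a c b] by blast
qed

section \<open>From triangles to all edges\<close>

lemma one_trivialI:
  assumes "\<And>x y z. triangle x y z \<Longrightarrow> cls x y = cls y z"
  shows "one_trivial (edges G) R"
  unfolding one_trivial_cls_iff
proof (intro allI impI)
  fix a b x y
  assume ab: "adj a b" and xy: "adj x y"
  have inc: "cls u v = cls v w" if "adj u v" "adj v w" for u v w
    using that assms[of u v w] cls_induced_P3[of u v w] by (auto simp: triangle_def)
  \<comment> \<open>The statement that all edges at a vertex lie in the class of \<open>xy\<close>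
    passes to its neighbours, because incident edges share a class.\<close>
  have "\<forall>w. adj a w \<longrightarrow> cls a w = cls x y"
  proof (rule reachable_induct[of x a])
    show "\<forall>w. adj x w \<longrightarrow> cls x w = cls x y"
      using inc[of y x] xy adj_commute[of x y] cls_commute[of x y] by metis
    show "\<forall>w. adj v w \<longrightarrow> cls v w = cls x y"
      if "\<forall>w. adj u w \<longrightarrow> cls u w = cls x y" "adj u v" for u v
      using inc[of u v] that by metis
  qed (use adjD[OF ab] adjD[OF xy] in simp_all)
  with ab show "cls a b = cls x y" by blast
qed

section \<open>Classes in complete multipartite graphs\<close>

lemma contains_complete_graphI:
  assumes "sorted_wrt adj xs" "set xs \<subseteq> verts G"
  shows "contains_induced G (complete_graph (length xs))"
proof (rule contains_induced_listI[where xs = xs])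
  have *: "adj (xs ! i) (xs ! j)" if "i < j" "j < length xs" for i j
    using assms(1) that by (auto simp: sorted_wrt_iff_nth_less)
  then have "adj (xs ! i) (xs ! j)" if "i < length xs" "j < length xs" "i \<noteq> j" for i j
    using that by (metis adj_commute nat_neq_iff)
  then show "adj (xs ! i) (xs ! j) \<longleftrightarrow> {i, j} \<in> edges (complete_graph (length xs))"
    if "i < length xs" "j < length xs" for i j
    using that by auto
  show "distinct xs"
    unfolding distinct_conv_nth using * adjD by (metis nat_neq_iff)
qed (use assms(2) in auto)

text \<open>The five vertices lie in distinct parts, and at most three of them in the parts of
  \<open>x\<close>, \<open>y\<close>, \<open>z\<close>. The other two form an edge that spans a
  \<open>K\<^sub>4\<close> with each side of the triangle.\<close>

lemma multipartite_one_trivial_if_K5: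
  assumes mp: "multipartite" and "contains_induced G (complete_graph 5)"
  shows "one_trivial (edges G) R"
proof (rule one_trivialI)
  fix x y z
  assume t: "triangle x y z"
  have xyz: "x \<in> verts G" "y \<in> verts G" "z \<in> verts G"
    using t adjD unfolding triangle_def by blast+
  from assms(2) obtain k :: "nat \<Rightarrow> 'a" where k: "\<And>i. i < 5 \<Longrightarrow> k i \<in> verts G"
    "\<And>i j. i < 5 \<Longrightarrow> j < 5 \<Longrightarrow> adj (k i) (k j) \<longleftrightarrow> i \<noteq> j"
    by (rule contains_induced_natE[where n = 5]) auto
  define N where "N v = {i. i < 5 \<and> \<not> adj v (k i)}" for v
  have fin: "finite (N v)" for v
    by (simp add: N_def)
  have N: "card (N v) \<le> 1" if "v \<in> verts G" for v
  proof -
    have "i = j" if "i \<in> N v" "j \<in> N v" for i j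
      using that \<open>v \<in> verts G\<close> mp k unfolding multipartite_def N_def
      by (metis (mono_tags, lifting) adj_commute mem_Collect_eq)
    with fin show ?thesis by (simp add: card_le_Suc0_iff_eq)
  qed
  let ?M = "N x \<union> N y \<union> N z"
  have "card ?M \<le> 3"
    using N[OF xyz(1)] N[OF xyz(2)] N[OF xyz(3)] card_Un_le[of "N x" "N y"]
      card_Un_le[of "N x \<union> N y" "N z"] by linarith
  then have "\<not> card ({..<5} - ?M) \<le> Suc 0"
    using diff_card_le_card_Diff[of ?M "{..<5}"] fin by simp
  then obtain i j where "i \<in> {..<5} - ?M" "j \<in> {..<5} - ?M" "i \<noteq> j"
    by (subst (asm) card_le_Suc0_iff_eq) auto
  then have a: "adj x (k i)" "adj y (k i)" "adj z (k i)" "adj x (k j)" "adj y (k j)" "adj z (k j)"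
    "adj (k i) (k j)"
    using k(2) by (auto simp: N_def)
  have "cls x y = cls (k i) (k j)" "cls y z = cls (k i) (k j)"
    using a t cls_K4[of x y "k i" "k j"] cls_K4[of y z "k i" "k j"] by (simp_all add: triangle_def)
  then show "cls x y = cls y z" by simp
qed

text \<open>The distance of \<open>a\<close> and \<open>c\<close> is 0 or 2, as they may coincide,
  and the other three are 1. One sum is therefore 1 or 3, the other 2.\<close>

lemma multipartite_Theta:
  assumes "adj a b" "\<not> adj a c" "adj b c" "adj d a" "adj d b" "adj d c"
  shows "({a, b}, {c, d}) \<in> Theta G"
proof -
  have "gdist G a c = 0 \<or> gdist G a c = 2"
    using assms gdist_self[of a] gdist_two[of a b c] adjD[of a b] by (cases "a = c") auto
  moreover have "gdist G b d = 1" "gdist G a d = 1" "gdist G b c = 1"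
    using assms gdist_adj by (metis adj_commute)+
  ultimately show ?thesis
    using assms by (subst Theta_iff) (auto simp: insert_commute)
qed

text \<open>Without a \<open>K\<^sub>5\<close> there are at most four parts. Pairing the parts of \<open>x\<close> and \<open>y\<close> against the
  other ones splits the vertices into two sides with at most two parts each, and no edge between
  the sides is related to an edge within a side.\<close>

lemma multipartite_not_one_trivial:
  assumes mp: "multipartite" and t: "triangle x y z"
    and K5: "\<not> contains_induced G (complete_graph 5)"
  shows "\<not> one_trivial (edges G) R"
proof
  assume "one_trivial (edges G) R"
  then have "cls x y = cls x z"
    using t unfolding one_trivial_cls_iff triangle_def by blast
  have xyz: "x \<in> verts G" "y \<in> verts G" "adj x y" "adj z x" "adj z y"
    using t adjD unfolding triangle_def by (auto simp: insert_commute)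
  have nt: "\<not> adj u w" if "\<not> adj u v" "\<not> adj v w" "u \<in> verts G" "v \<in> verts G" "w \<in> verts G" for u v w
    using mp that unfolding multipartite_def by blast
  \<comment> \<open>Vertices outside the parts of \<open>x\<close> and \<open>y\<close>.\<close>
  define side where "side v \<longleftrightarrow> adj v x \<and> adj v y" for v
  have cross: "adj u v" if "side u" "\<not> side v" "v \<in> verts G" for u v
  proof -
    have "u \<in> verts G" using that(1) adjD unfolding side_def by blast
    with that nt[of u v x] nt[of u v y] xyz show ?thesis unfolding side_def by blast
  qed
  \<comment> \<open>No triangle stays on one side: outside the two parts it would form a
    \<open>K\<^sub>5\<close> with \<open>x\<close> and \<open>y\<close>; inside, two of its vertices
    would share a part.\<close>
  have two_parts: False if "adj a b" "adj b c" "adj a c" "side a = side b" "side a = side c" for a b c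
  proof (cases "side a")
    case True
    with that xyz have "sorted_wrt adj [a, b, c, x, y]" "set [a, b, c, x, y] \<subseteq> verts G"
      using adjD by (auto simp: side_def)
    from contains_complete_graphI[OF this] K5 show False
      by (simp add: eval_nat_numeral)
  next
    case False
    have "a \<in> verts G" "b \<in> verts G" "c \<in> verts G"
      using that adjD by blast+
    moreover have "adj u v \<longleftrightarrow> adj v u" for u v by (rule adj_commute)
    ultimately show False
      using False that nt xyz unfolding side_def by (smt (verit))
  qed
  \<comment> \<open>On its side, \<open>c\<close> shares a part with exactly one of \<open>a\<close>
    and \<open>b\<close>, while \<open>d\<close> sees all three; this is the situation of
    \<open>multipartite_Theta\<close>.\<close>
  have Theta: "({a, b}, {c, d}) \<in> Theta G"
    if "adj a b" "adj c d" "side a = side b" "side c = side a" "side d \<noteq> side a" for a b c d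
  proof -
    have V: "a \<in> verts G" "b \<in> verts G" "c \<in> verts G" "d \<in> verts G"
      using that adjD by blast+
    have d: "adj d a" "adj d b" "adj d c"
      using cross that V by (metis adj_commute)+
    have "\<not> adj a c \<or> \<not> adj b c"
      using two_parts[of a b c] that by auto
    moreover have "adj a c \<or> adj b c"
      using nt[of a c b] that V by (auto simp: insert_commute)
    ultimately show ?thesis
      using multipartite_Theta[of a b c d] multipartite_Theta[of b a c d] d that(1)
      by (auto simp: insert_commute)
  qed
  \<comment> \<open>A property preserved by the relation that separates \<open>xy\<close> from
    \<open>xz\<close>: \<open>x\<close> and \<open>y\<close> fail \<open>side\<close>, since no
    vertex sees itself, while \<open>z\<close> satisfies it.\<close>
  define within where "within e \<longleftrightarrow> (\<exists>a b. e = {a, b} \<and> side a = side b)" for e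
  have step: "within f" if "within e" "(e, f) \<in> Theta_bar G" for e f
  proof (rule ccontr)
    assume n: "\<not> within f"
    from that obtain a b where e: "e = {a, b}" "side a = side b"
      unfolding within_def by blast
    from that(2) have ab: "adj a b" and "f \<in> edges G" and "e = f \<or> (e, f) \<notin> Theta G"
      unfolding Theta_bar_def e(1) by (simp_all, blast)
    moreover from \<open>f \<in> edges G\<close> obtain c d where f: "f = {c, d}" "adj c d"
      by (rule edgeE)
    moreover have "e \<noteq> f" using n that by auto
    moreover have "side c \<noteq> side d" using n f unfolding within_def by blast
    ultimately show False
      using Theta[of a b c d] Theta[of a b d c] e by (auto simp: insert_commute)
  qed
  have "within f" if "(e, f) \<in> R" "within e" for e f
    using that by (induction rule: trancl_induct) (auto intro: step)
  moreover have "within {x, y}"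
    unfolding within_def side_def by (intro exI[of _ x] exI[of _ y]) simp
  moreover have "({x, y}, {x, z}) \<in> R"
    using \<open>cls x y = cls x z\<close> equiv_R t unfolding cls_def triangle_def
    by (metis eq_equiv_class_iff)
  ultimately have "within {x, z}" by blast
  then show False
    using xyz unfolding within_def side_def by (auto simp: doubleton_eq_iff)
qed

section \<open>Pattern graphs and complete multipartite graphs\<close>

lemma multipartite_no_paw:
  assumes "multipartite"
  shows "graph_free G paw_graph"
proof
  assume "contains_induced G paw_graph"
  then obtain g where g: "\<And>i. i < 4 \<Longrightarrow> g i \<in> verts G"
    "\<And>i j. i < 4 \<Longrightarrow> j < 4 \<Longrightarrow> adj (g i) (g j) \<longleftrightarrow> {i, j} \<in> edges paw_graph"
    by (rule contains_induced_natE[where n = 4]) auto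
  \<comment> \<open>The pendant vertex 3 misses both ends of the edge between 0 and 1.\<close>
  have "\<not> adj (g 0) (g 3)" "\<not> adj (g 3) (g 1)" "adj (g 0) (g 1)"
    by (simp_all add: g(2) doubleton_eq_iff)
  moreover have "g 0 \<in> verts G" "g 1 \<in> verts G" "g 3 \<in> verts G"
    by (simp_all add: g(1))
  ultimately show False
    using assms unfolding multipartite_def by blast
qed

lemma multipartite_no_P4:
  assumes "multipartite"
  shows "graph_free G (path_graph 4)"
proof
  assume "contains_induced G (path_graph 4)"
  then obtain g where g: "\<And>i. i < 4 \<Longrightarrow> g i \<in> verts G"
    "\<And>i j. i < 4 \<Longrightarrow> j < 4 \<Longrightarrow> adj (g i) (g j) \<longleftrightarrow> {i, j} \<in> edges (path_graph 4)"
    by (rule contains_induced_natE[where n = 4]) auto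
  \<comment> \<open>The end 3 of the path misses both ends of the edge between 0 and 1.\<close>
  have "\<not> adj (g 0) (g 3)" "\<not> adj (g 3) (g 1)" "adj (g 0) (g 1)"
    by (simp_all add: g(2))
  moreover have "g 0 \<in> verts G" "g 1 \<in> verts G" "g 3 \<in> verts G"
    by (simp_all add: g(1))
  ultimately show False
    using assms unfolding multipartite_def by blast
qed

text \<open>The arguments of \<open>paw\<close> follow the numbering of \<open>paw_graph\<close>,
  with the pendant vertex last and its neighbour just before it.\<close>

lemma contains_pawI:
  assumes "paw a b c d"
  shows "contains_induced G paw_graph"
proof (rule contains_induced_listI[where xs = "[a, b, c, d]"])
  have *: "adj a b" "adj a c" "adj b c" "adj c d" "\<not> adj a d" "\<not> adj b d"
    using assms by (auto simp: paw_def)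
  then have s: "adj b a" "adj c a" "adj c b" "adj d c" "\<not> adj d a" "\<not> adj d b"
    by (simp_all add: insert_commute)
  from * s show "distinct [a, b, c, d]" "set [a, b, c, d] \<subseteq> verts G"
    using adjD by auto
  show "adj ([a, b, c, d] ! i) ([a, b, c, d] ! j) \<longleftrightarrow> {i, j} \<in> edges paw_graph"
    if "i < length [a, b, c, d]" "j < length [a, b, c, d]" for i j
    using that * s
    by (auto simp: less_Suc_eq numeral_eq_Suc doubleton_eq_iff)
qed simp

text \<open>Used contrapositively: the three small exceptions are complete multipartite, so a graph
  that is not multipartite is none of them.\<close>

lemma multipartite_if_iso:
  fixes H :: "nat ugraph"
  assumes "graph_iso G H" "verts H = {..<n}"
    and "\<And>i j k. i < n \<Longrightarrow> j < n \<Longrightarrow> k < n \<Longrightarrow>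
      {i, j} \<notin> edges H \<Longrightarrow> {j, k} \<notin> edges H \<Longrightarrow> {i, k} \<notin> edges H"
  shows multipartite
proof -
  from assms(1,2) obtain g where g: "bij_betw g {..<n} (verts G)"
    "\<And>i j. i < n \<Longrightarrow> j < n \<Longrightarrow> adj (g i) (g j) \<longleftrightarrow> {i, j} \<in> edges H"
    by (rule graph_iso_natE) auto
  have V: "verts G = g ` {..<n}"
    using g(1) by (simp add: bij_betw_def)
  show ?thesis
    unfolding multipartite_def V
  proof (intro ballI impI)
    fix a b c
    assume "a \<in> g ` {..<n}" "b \<in> g ` {..<n}" "c \<in> g ` {..<n}"
    then obtain i j k where "a = g i" "b = g j" "c = g k" "i < n" "j < n" "k < n"
      by blast
    then show "\<not> adj a c" if "\<not> adj a b" "\<not> adj b c"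
      using that assms(3)[of i j k] by (simp add: g(2))
  qed
qed

text \<open>There is at most one vertex outside the triangle, and it misses at most one triangle
  vertex, because those lie in distinct parts.\<close>

lemma pattern_if_small_multipartite:
  assumes mp: "multipartite" and t: "triangle x y z"
    and "finite (verts G)" "card (verts G) \<le> 4"
  shows "graph_iso G (complete_graph 3) \<or> graph_iso G diamond_graph \<or> graph_iso G (complete_graph 4)"
proof -
  have a: "adj x y" "adj y z" "adj x z" "adj y x" "adj z y" "adj z x"
    using t by (simp_all add: triangle_def insert_commute)
  then have d: "x \<noteq> y" "y \<noteq> z" "x \<noteq> z" and V: "{x, y, z} \<subseteq> verts G"
    using adjD by blast+
  show ?thesis
  proof (cases "verts G = {x, y, z}")
    case True
    have "graph_iso G (complete_graph 3)"
      by (rule graph_iso_listI[where xs = "[x, y, z]"])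
        (use a d True in \<open>auto simp: less_Suc_eq numeral_eq_Suc\<close>)
    then show ?thesis by blast
  next
    case False
    with V obtain v where v: "v \<in> verts G" "v \<notin> {x, y, z}" by blast
    have W: "{v, x, y, z} = verts G"
      using assms(3,4) v V d by (intro card_seteq) auto
    \<comment> \<open>The non-adjacent pair \<open>v\<close>, \<open>p\<close> comes first, since
      \<open>diamond_graph\<close> lacks the edge between 0 and 1.\<close>
    have diamond: "graph_iso G diamond_graph"
      if "{v, p, q, r} = verts G" "distinct [v, p, q, r]" "triangle p q r" "\<not> adj v p" for p q r
    proof (rule graph_iso_listI[where xs = "[v, p, q, r]"])
      have b: "adj p q" "adj q r" "adj p r" "adj q p" "adj r q" "adj r p" "\<not> adj p v"
        using that(3,4) by (simp_all add: triangle_def insert_commute)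
      then have "adj q v" "adj r v"
        using mp that(1,4) unfolding multipartite_def by blast+
      with b that(4) have c: "adj q v" "adj r v" "adj v q" "adj v r"
        by (simp_all add: insert_commute)
      show "adj ([v, p, q, r] ! i) ([v, p, q, r] ! j) \<longleftrightarrow> {i, j} \<in> edges diamond_graph"
        if "i < length [v, p, q, r]" "j < length [v, p, q, r]" for i j
        using that b c \<open>\<not> adj v p\<close>
        by (auto simp: less_Suc_eq numeral_eq_Suc doubleton_eq_iff)
    qed (use that in auto)
    show ?thesis
    proof (cases "adj v x \<and> adj v y \<and> adj v z")
      case True
      then have "adj x v" "adj y v" "adj z v"
        by (simp_all add: insert_commute)
      then have "graph_iso G (complete_graph 4)"
        by (intro graph_iso_listI[where xs = "[v, x, y, z]"])
          (use True a d v W in \<open>auto simp: less_Suc_eq numeral_eq_Suc\<close>)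
      then show ?thesis by blast
    next
      case False
      have "triangle y z x" "triangle z x y"
        using t triangle_rotate by blast+
      with False t diamond[of x y z] diamond[of y z x] diamond[of z x y] W v d show ?thesis
        by (auto simp: insert_commute)
    qed
  qed
qed

lemma triangle_if_contains_K3:
  assumes "contains_induced G (complete_graph 3)"
  shows "\<exists>x y z. triangle x y z"
proof -
  from assms obtain g :: "nat \<Rightarrow> 'a" where "\<And>i j. i < 3 \<Longrightarrow> j < 3 \<Longrightarrow> adj (g i) (g j) \<longleftrightarrow> i \<noteq> j"
    by (rule contains_induced_natE[where n = 3]) auto
  then have "triangle (g 0) (g 1) (g 2)"
    by (simp add: triangle_def)
  then show ?thesis by blast
qed

lemma contains_K3_if_triangle:
  assumes "triangle x y z"
  shows "contains_induced G (complete_graph 3)"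
proof -
  have "sorted_wrt adj [x, y, z]" "set [x, y, z] \<subseteq> verts G"
    using assms adjD by (auto simp: triangle_def)
  from contains_complete_graphI[OF this] show ?thesis
    by (simp add: eval_nat_numeral)
qed

lemma card_if_contains_complete_graph:
  assumes "contains_induced G (complete_graph n)" "finite (verts G)"
  shows "n \<le> card (verts G)"
proof -
  from assms(1) obtain S where S: "S \<subseteq> verts G" "graph_iso (induced_subgraph G S) (complete_graph n)"
    unfolding contains_induced_def by blast
  then have "card S = n"
    unfolding graph_iso_def by (auto simp: induced_subgraph_def dest: bij_betw_same_card)
  with S(1) assms(2) show ?thesis
    by (metis card_mono)
qed

lemma triangle_if_iso:
  fixes H :: "nat ugraph"
  assumes "graph_iso G H" "verts H = {..<n}" "i < n" "j < n" "k < n"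
    and "{i, j} \<in> edges H" "{j, k} \<in> edges H" "{i, k} \<in> edges H"
  shows "\<exists>x y z. triangle x y z"
proof -
  from assms(1,2) obtain g where
    "\<And>i j. i < n \<Longrightarrow> j < n \<Longrightarrow> adj (g i) (g j) \<longleftrightarrow> {i, j} \<in> edges H"
    by (rule graph_iso_natE) auto
  with assms have "triangle (g i) (g j) (g k)"
    by (simp add: triangle_def)
  then show ?thesis by blast
qed

end

section \<open>The three cases: triangle-free, not multipartite, multipartite with a
  triangle\<close>

theorem proposition3p12:
  fixes G :: "'a ugraph"
  assumes "simple_graph G" and "connected_graph G"
  shows "one_trivial (edges G) ((Theta_bar G)\<^sup>+) \<longleftrightarrow>
      (finite (verts G) \<and> card (verts G) \<le> 4 \<and>
         \<not> graph_iso G (complete_graph 3) \<and>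
         \<not> graph_iso G diamond_graph \<and>
         \<not> graph_iso G (complete_graph 4))
      \<or> ((infinite (verts G) \<or> 5 \<le> card (verts G)) \<and>
         (graph_free G (complete_graph 3) \<or>
          contains_induced G (complete_graph 5) \<or>
          contains_induced G paw_graph \<or>
          contains_induced G (path_graph 4)))"
    (is "?triv \<longleftrightarrow> ?small \<and> ?card4 \<and> ?noiso \<or> ?large \<and> ?sub")
proof -
  interpret connected_simple_graph G
    using assms by unfold_locales
  \<comment> \<open>The size conditions are complementary, so the right-hand side holds as soon as
    \<open>?noiso\<close> and \<open>?sub\<close> both do.\<close>
  have size: "\<not> (?small \<and> ?card4) \<longleftrightarrow> ?large"
    by auto
  consider (no_triangle) "\<nexists>x y z. triangle x y z"
    | (not_multipartite) x y z where "triangle x y z" "\<not> multipartite"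
    | (multipartite) x y z where "triangle x y z" multipartite
    by blast
  then show ?thesis
  proof cases
    case no_triangle
    then have ?triv
      by (intro one_trivialI) blast
    \<comment> \<open>Each exception contains a triangle; in the diamond it must avoid the missing
      edge, hence the vertices 1, 2, 3.\<close>
    moreover have ?noiso
      using no_triangle triangle_if_iso[of "complete_graph 3" 3 0 1 2]
        triangle_if_iso[of diamond_graph 4 1 2 3] triangle_if_iso[of "complete_graph 4" 4 0 1 2]
      by (auto simp: doubleton_eq_iff)
    moreover have ?sub
      using no_triangle triangle_if_contains_K3 by blast
    ultimately show ?thesis using size by blast
  next
    case not_multipartite
    have "mono_triangle u v w" if "triangle u v w" for u v w
      using mono_triangle_if_not_multipartite that not_multipartite(2) .
    then have ?triv
      by (intro one_trivialI) (simp add: mono_triangle_def)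
    moreover have ?noiso
      using not_multipartite(2) multipartite_if_iso[of "complete_graph 3" 3]
        multipartite_if_iso[of diamond_graph 4] multipartite_if_iso[of "complete_graph 4" 4]
      by (auto simp: doubleton_eq_iff)
    moreover have ?sub
      using mono_triangle_if_not_multipartite[OF not_multipartite] contains_pawI
      unfolding mono_triangle_def by blast
    ultimately show ?thesis using size by blast
  next
    case multipartite
    have triv: "?triv \<longleftrightarrow> contains_induced G (complete_graph 5)"
      using multipartite multipartite_one_trivial_if_K5 multipartite_not_one_trivial by blast
    \<comment> \<open>A triangle is present and induced paws and \<open>P\<^sub>4\<close>s are
      excluded, which leaves only the \<open>K\<^sub>5\<close>.\<close>
    have sub: "?sub \<longleftrightarrow> contains_induced G (complete_graph 5)"
      using multipartite multipartite_no_paw multipartite_no_P4 contains_K3_if_triangle by blast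
    show ?thesis
    proof (cases "?small \<and> ?card4")
      case True
      then have "\<not> ?noiso"
        using pattern_if_small_multipartite multipartite by blast
      moreover have "\<not> contains_induced G (complete_graph 5)"
        using True card_if_contains_complete_graph[of 5] by auto
      ultimately show ?thesis using True size triv by blast
    next
      case False
      with size triv sub show ?thesis by blast
    qed
  qed
qed

end
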